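(* Let $q$ be a power of an odd prime. For any pairwise distinct elements $a,b,c \in \mathbb{F}_q$, we have $$\left| L_q(a,b,c) - \frac{q}{8} \right| \le \frac{1}{4} q^{1/2} + 2.$$
   Context: $\mathbb{F}_q$ is the finite field of $q$ elements. For polynomials $f_1,\ldots,f_n \in \mathbb{F}_q[X]$, $\mathcal{G}(f_1,\ldots,f_n)$ is the directed graph with nodes labelled by the elements of $\mathbb{F}_q$ and with an edge from $u$ to $v$ ($u,v\in\mathbb{F}_q$) if and only if $f_i(u)=v$ for some $i=1,\ldots,n$. A leaf is a vertex of in-degree $0$. For pairwise distinct $a,b,c\in\mathbb{F}_q$, $L_q(a,b,c)$ denotes the number of leaves in $\mathcal{G}(X^2+a,X^2+b,X^2+c)$. *)

theory Defs
  imports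
    Complex_Main
    "HOL-Computational_Algebra.Primes"
    "HOL-Computational_Algebra.Polynomial"
    "HOL-Library.Cardinality"
    "Graph_Theory.Digraph"
begin

text \<open>
  The finite field with \<open>q\<close> elements is a type \<open>'a\<close> of sort \<open>{field, finite}\<close> with
  \<open>CARD('a) = q\<close>. There is at most one edge from \<open>u\<close> to \<open>v\<close>, even if several of the
  polynomials map \<open>u\<close> to \<open>v\<close>; loops are allowed.
\<close>

definition poly_graph :: "'a::{field, finite} poly list \<Rightarrow> ('a, 'a \<times> 'a) pre_digraph" where
  "poly_graph fs =
     \<lparr>verts = UNIV, arcs = {(u, v). \<exists>f \<in> set fs. poly f u = v}, tail = fst, head = snd\<rparr>"

lemma fin_digraph_poly_graph: "fin_digraph (poly_graph fs)"
  by unfold_locales (simp_all add: poly_graph_def)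

definition leaves :: "('v, 'e) pre_digraph \<Rightarrow> 'v set" where
  "leaves G = {v \<in> verts G. in_degree G v = 0}"

definition leaf_count :: "'a::{field, finite} \<Rightarrow> 'a \<Rightarrow> 'a \<Rightarrow> nat" where
  "leaf_count a b c =
     card (leaves (poly_graph [monom 1 2 + [:a:], monom 1 2 + [:b:], monom 1 2 + [:c:]]))"

end

theory Submission
  imports Defs "HOL-Computational_Algebra.Polynomial_Factorial"
begin

text \<open>
  A vertex \<open>v\<close> is a leaf iff none of \<open>v - a\<close>, \<open>v - b\<close>, \<open>v - c\<close> is a square. With the quadratic
  character \<open>\<chi>\<close>, the product \<open>(1 - \<chi> (v - a)) (1 - \<chi> (v - b)) (1 - \<chi> (v - c))\<close> is \<open>8\<close> at a
  leaf and \<open>0\<close> elsewhere, except at \<open>a\<close>, \<open>b\<close>, \<open>c\<close>, where it lies between \<open>0\<close> and \<open>4\<close>. Summing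
  the expanded product over \<open>v\<close>, the linear terms vanish and each of the three quadratic terms
  gives \<open>-1\<close>, so \<open>8 L = q - 3 - T - e\<close> with \<open>0 \<le> e \<le> 12\<close> and
  \<open>T = (\<Sum>v. \<chi> ((v - a) (v - b) (v - c)))\<close> (lemma \<open>leaf_count_char_sum\<close>). The theorem follows
  from Hasse's bound \<open>\<bar>T\<bar> \<le> 2 sqrt q\<close> (lemma \<open>hasse_bound_split_cubic\<close>); the constant is
  \<open>15 / 8 \<le> 2\<close>.

  Hasse's bound is proved by Manin's elementary method. Put \<open>F = x\<^sup>3 + A x\<^sup>2 + B x\<close> and let \<open>t\<close> be
  an indeterminate. The twisted curve \<open>F(t) y\<^sup>2 = F(x)\<close> over the rational function field in \<open>t\<close>
  carries the point \<open>Q = (t, 1)\<close> and its Frobenius image \<open>P = (t^q, F(t)^((q-1)/2))\<close>. Let \<open>d n\<close> be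
  the degree of the numerator of the reduced fraction \<open>x(P + n Q)\<close>. Then \<open>d 0 = q\<close>,
  \<open>d (n + 1) + d (n - 1) = 2 d n + 2\<close> (lemma \<open>translate_step\<close>), and one of the neighbours of
  \<open>d 0\<close> is \<open>q + 1 + T\<close>, by counting the cancellations in the addition formula (lemma
  \<open>frobenius_translate_pair\<close>). Hence \<open>d n = n\<^sup>2 + T n + q\<close> for every integer \<open>n\<close>, up to the
  orientation of \<open>n\<close>. As degrees are not negative and \<open>T\<close> is even, the value at \<open>n = - T / 2\<close>
  gives \<open>T\<^sup>2 \<le> 4 q\<close>.

  The group law itself is avoided: only \<open>x\<close>-coordinates are used, as homogeneous pairs of
  polynomials. The numbers \<open>x(R + Q)\<close> and \<open>x(R - Q)\<close> are the two roots of a quadratic equation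
  whose coefficients are polynomials in \<open>x(R)\<close> (the definition \<open>translate_form\<close>), so one of them
  determines the other.
\<close>

section \<open>Coprime polynomials over a field\<close>

text \<open>
  For polynomials over a field this is coprimality. It is phrased with primes because the pairs
  below are shown to be coprime by reduction modulo a common prime.
\<close>

definition no_common_prime :: "'a::comm_semiring_1 \<Rightarrow> 'a \<Rightarrow> bool" where
  "no_common_prime x y \<longleftrightarrow> (\<forall>r. prime_elem r \<longrightarrow> \<not> (r dvd x \<and> r dvd y))"

lemma prime_divisor_field_poly:
  fixes g :: "'a::field poly"
  assumes "\<not> is_unit g"
  shows "\<exists>r. prime_elem r \<and> r dvd g"
proof (cases "g = 0")
  case True
  have "prime_elem [:0, 1 :: 'a:]"
    by (rule prime_elem_linear_field_poly) simp
  then show ?thesis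
    unfolding True by (intro exI[of _ "[:0, 1:]"]) simp
next
  case False
  then show ?thesis
    using assms
  proof (induction "degree g" arbitrary: g rule: less_induct)
    case less
    show ?case
    proof (cases "irreducible g")
      case True
      then show ?thesis
        using field_poly_irreducible_imp_prime[of g] by (intro exI[of _ g]) simp
    next
      case False
      then obtain h k where g: "g = h * k" and nu: "\<not> is_unit h" "\<not> is_unit k"
        using less.prems irreducibleI[of g] by auto
      have nz: "h \<noteq> 0" "k \<noteq> 0"
        using g less.prems(1) by auto
      then have "degree k \<noteq> 0"
        using nu by (simp add: is_unit_iff_degree)
      then have "degree h < degree g"
        using g nz by (simp add: degree_mult_eq)
      then obtain r where "prime_elem r" "r dvd h"
        using less.hyps[of h] nz(1) nu(1) by auto
      then show ?thesis
        unfolding g by (intro exI[of _ r]) simp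
    qed
  qed
qed

text \<open>Euclid's algorithm: a common prime of \<open>y\<close> and \<open>x mod y\<close> is one of \<open>x\<close> and \<open>y\<close>.\<close>

lemma bezout_field_poly:
  fixes x y :: "'a::field poly"
  assumes "no_common_prime x y"
  shows "\<exists>r s. r * x + s * y = 1"
  using assms
proof (induction "euclidean_size y" arbitrary: x y rule: less_induct)
  case less
  show ?case
  proof (cases "y = 0")
    case True
    then have "is_unit x"
      using less.prems prime_divisor_field_poly[of x] by (auto simp: no_common_prime_def)
    then obtain r where "1 = x * r"
      by (elim dvdE)
    then show ?thesis
      using True by (intro exI[of _ r]) (simp add: mult.commute)
  next
    case False
    have "no_common_prime y (x mod y)"
      using less.prems by (auto simp: no_common_prime_def dvd_mod_iff)
    then obtain r s where rs: "r * y + s * (x mod y) = 1"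
      using less.hyps[of "x mod y" y] mod_size_less[OF False] by blast
    have "x mod y = x - x div y * y"
      by (simp add: minus_div_mult_eq_mod)
    then have "s * x + (r - s * (x div y)) * y = 1"
      using rs by algebra
    then show ?thesis
      by blast
  qed
qed

lemma dvd_mult_cancel_no_common_prime:
  fixes x y z :: "'a::field poly"
  assumes "no_common_prime x y" and "x dvd y * z"
  shows "x dvd z"
proof -
  obtain r s where "r * x + s * y = 1"
    using bezout_field_poly[OF assms(1)] by blast
  then have "z = x * (r * z) + s * (y * z)"
    by algebra
  also have "x dvd \<dots>"
    using assms(2) by (intro dvd_add dvd_mult[of x "y * z"]) auto
  finally show ?thesis .
qed

section \<open>The translates of a point by (t, 1), seen through their x-coordinates\<close>

text \<open>
  Write \<open>x(R) = u / v\<close>. On \<open>F(t) y\<^sup>2 = x\<^sup>3 + A x\<^sup>2 + B x\<close>, where \<open>F(t) = t\<^sup>3 + A t\<^sup>2 + B t\<close>, the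
  addition formulas give
  \<open>x(R + Q) x(R - Q) = prod_form / diff_form\<close> and
  \<open>x(R + Q) + x(R - Q) = 2 half_sum_form / diff_form\<close>.
  The denominator \<open>diff_form\<close> is the square of the difference \<open>u - t v\<close>.
\<close>
definition diff_form :: "'r::comm_ring_1 \<Rightarrow> 'r \<Rightarrow> 'r \<Rightarrow> 'r" where
  "diff_form t u v = (u - t * v)\<^sup>2"

definition prod_form :: "'r::comm_ring_1 \<Rightarrow> 'r \<Rightarrow> 'r \<Rightarrow> 'r \<Rightarrow> 'r" where
  "prod_form t B u v = (t * u - B * v)\<^sup>2"

definition half_sum_form :: "'r::comm_ring_1 \<Rightarrow> 'r \<Rightarrow> 'r \<Rightarrow> 'r \<Rightarrow> 'r \<Rightarrow> 'r" where
  "half_sum_form t A B u v = (t * u + B * v) * (u + t * v) + 2 * A * t * u * v"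

text \<open>
  This form vanishes iff \<open>z / w\<close> is \<open>x(R + Q)\<close> or \<open>x(R - Q)\<close>, also when one of the points is at
  infinity. It is symmetric, since \<open>R\<close> is a translate of each of its own translates.
\<close>
definition translate_form :: "'r::comm_ring_1 \<Rightarrow> 'r \<Rightarrow> 'r \<Rightarrow> 'r \<Rightarrow> 'r \<Rightarrow> 'r \<Rightarrow> 'r \<Rightarrow> 'r" where
  "translate_form t A B u v z w =
     diff_form t u v * z\<^sup>2 - 2 * half_sum_form t A B u v * z * w + prod_form t B u v * w\<^sup>2"

lemmas form_defs = diff_form_def prod_form_def half_sum_form_def translate_form_def

lemma translate_form_sym:
  "translate_form t A B u v z w = translate_form t A B z w u v"
  unfolding form_defs by (simp add: algebra_simps power2_eq_square)

text \<open>
  A quarter of the discriminant of the form is \<open>4 F(t) F(x(R)) v\<^sup>4\<close>. It becomes a square once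
  \<open>F(x(R)) = F(t) y\<^sup>2\<close>, which is why \<open>x(R + Q)\<close> and \<open>x(R - Q)\<close> are rational.
\<close>
lemma discriminant_identity:
  "(half_sum_form t A B u v)\<^sup>2 - diff_form t u v * prod_form t B u v
     = 4 * (t * (t\<^sup>2 + A * t + B)) * (v * u * (u\<^sup>2 + A * u * v + B * v\<^sup>2))"
  unfolding form_defs by (simp add: algebra_simps power2_eq_square)

text \<open>
  A fraction in lowest terms whose value is infinite at \<open>t = \<infinity>\<close>. The condition on the degrees
  is an invariant of the translations; under it the numerator alone carries the height of the
  point. The pair \<open>(u, 0)\<close> with \<open>u\<close> constant is the point at infinity.
\<close>
definition reduced_point :: "'a::field poly \<Rightarrow> 'a poly \<Rightarrow> bool" where
  "reduced_point u v \<longleftrightarrow> u \<noteq> 0 \<and> (v = 0 \<or> degree v < degree u) \<and> no_common_prime u v"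

text \<open>
  If \<open>u0 / v0\<close> is one root of the quadratic form, the cofactor of \<open>v0 Z - u0 W\<close> is the other
  root \<open>u1 / v1\<close>, and \<open>u0 u1 = prod_form\<close> has degree \<open>2 deg u + 2\<close>. The fraction \<open>u1 / v1\<close> is in
  lowest terms because a common prime of \<open>u1\<close> and \<open>v1\<close> would divide all three coefficients of
  the form; modulo such a prime \<open>t\<^sup>2 = B \<noteq> 0\<close>, hence \<open>2 t + A = 0\<close>, so the prime would divide the
  constant \<open>A\<^sup>2 - 4 B\<close>, a nonzero factor of the discriminant of the curve.
\<close>
lemma translate_step:
  fixes a b :: "'a::field" and t A B u v u0 v0 :: "'a poly"
  defines "t \<equiv> [:0, 1:]" and "A \<equiv> [:a:]" and "B \<equiv> [:b:]"
  assumes two: "(2::'a) \<noteq> 0" and b: "b \<noteq> 0" and disc: "a\<^sup>2 \<noteq> 4 * b"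
    and red0: "reduced_point u0 v0" and red: "reduced_point u v"
    and rel: "translate_form t A B u v u0 v0 = 0"
  shows "\<exists>u1 v1. reduced_point u1 v1 \<and> translate_form t A B u1 v1 u v = 0
           \<and> degree u1 + degree u0 = 2 * degree u + 2"
proof -
  define \<alpha> where "\<alpha> = diff_form t u v"
  define \<gamma> where "\<gamma> = prod_form t B u v"
  define S where "S = half_sum_form t A B u v"
  have rel': "\<alpha> * u0\<^sup>2 - 2 * S * u0 * v0 + \<gamma> * v0\<^sup>2 = 0"
    using rel by (simp add: translate_form_def \<alpha>_def \<gamma>_def S_def)
  have u0: "u0 \<noteq> 0" and u: "u \<noteq> 0"
    and v0: "v0 = 0 \<or> degree v0 < degree u0" and v: "v = 0 \<or> degree v < degree u"
    and cop0: "no_common_prime u0 v0" and cop: "no_common_prime u v"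
    using red0 red by (auto simp: reduced_point_def)

  \<comment> \<open>Gauss's lemma: \<open>v0 Z - u0 W\<close> is a primitive factor of the binary quadratic form.\<close>
  have "u0 dvd v0 * (v0 * \<gamma>)"
  proof
    show "v0 * (v0 * \<gamma>) = u0 * (2 * S * v0 - \<alpha> * u0)"
      using rel' by algebra
  qed
  then have "u0 dvd \<gamma>"
    using dvd_mult_cancel_no_common_prime[OF cop0] by blast
  then obtain u1 where u1: "\<gamma> = u0 * u1" ..
  have "u0 * (v0 * (2 * S - u1 * v0)) = u0 * (\<alpha> * u0)"
    using rel' u1 by algebra
  then have *: "v0 * (2 * S - u1 * v0) = u0 * \<alpha>"
    using u0 by (simp add: mult.commute)
  then have "u0 dvd 2 * S - u1 * v0"
    using dvd_mult_cancel_no_common_prime[OF cop0] by (metis dvd_triv_left)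
  then obtain v1 where v1: "2 * S - u1 * v0 = u0 * v1" ..
  have "u0 * (v0 * v1) = u0 * \<alpha>"
    using * v1 by algebra
  then have v01: "\<alpha> = v0 * v1"
    using u0 by simp
  have sum: "2 * S = u0 * v1 + u1 * v0"
    using v1 by algebra
  have rel1: "translate_form t A B u v u1 v1 = 0"
    unfolding translate_form_def \<alpha>_def[symmetric] \<gamma>_def[symmetric] S_def[symmetric]
    using u1 v01 sum by algebra

  have deg_t: "degree (t * u) = degree u + 1"
    using u by (simp add: t_def degree_mult_eq)
  have deg_Bv: "degree (B * v) < degree u + 1"
    using v by (auto simp: B_def)
  have deg_diff: "degree (t * u - B * v) = degree u + 1"
    using degree_add_eq_left[of "- (B * v)" "t * u"] deg_t deg_Bv by simp
  then have "t * u - B * v \<noteq> 0"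
    by auto
  with deg_diff have deg_\<gamma>: "degree \<gamma> = 2 * degree u + 2" and "\<gamma> \<noteq> 0"
    unfolding \<gamma>_def prod_form_def by (auto simp: degree_power_eq)
  then have "u1 \<noteq> 0"
    using u1 by auto
  then have deg_sum: "degree u1 + degree u0 = 2 * degree u + 2"
    using deg_\<gamma> u1 u0 by (simp add: degree_mult_eq)
  have "degree S \<le> 2 * degree u + 1"
  proof -
    have tv: "degree (t * v) \<le> degree u"
      using v by (auto simp: t_def degree_mult_eq)
    have 1: "degree (t * u + B * v) \<le> degree u + 1"
      using deg_t deg_Bv by (intro degree_add_le) auto
    have 2: "degree (u + t * v) \<le> degree u"
      using tv by (intro degree_add_le) auto
    have "degree (2 * A * u) \<le> degree u"
    proof -
      have "2 * A * u = smult (2 * a) u"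
        by (simp add: A_def numeral_poly mult.commute)
      then show ?thesis
        by simp
    qed
    then have "degree ((2 * A * u) * (t * v)) \<le> degree u + degree u"
      using tv degree_mult_le[of "2 * A * u" "t * v"] by linarith
    moreover have "degree ((t * u + B * v) * (u + t * v)) \<le> (degree u + 1) + degree u"
      using 1 2 degree_mult_le[of "t * u + B * v" "u + t * v"] by linarith
    moreover have "S = (t * u + B * v) * (u + t * v) + (2 * A * u) * (t * v)"
      by (simp add: S_def half_sum_form_def mult_ac)
    ultimately show ?thesis
      by (auto intro!: degree_add_le)
  qed
  moreover have "degree (2 * S) = degree S"
  proof -
    have "2 * S = smult 2 S"
      by (simp add: numeral_poly)
    then show ?thesis
      using two by simp
  qed
  ultimately have deg_S: "degree (u0 * v1 + u1 * v0) \<le> 2 * degree u + 1"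
    using sum by simp
  \<comment> \<open>Otherwise \<open>u0 * v1\<close> would dominate in \<open>2 * S = u0 * v1 + u1 * v0\<close>, with too large a degree.\<close>
  have "v1 = 0 \<or> degree v1 < degree u1"
  proof (rule ccontr)
    assume "\<not> (v1 = 0 \<or> degree v1 < degree u1)"
    then have v1: "v1 \<noteq> 0" "degree u1 \<le> degree v1"
      by auto
    have big: "degree (u0 * v1) \<ge> 2 * degree u + 2"
      using v1 u0 deg_sum by (simp add: degree_mult_eq)
    have "degree (u0 * v1 + u1 * v0) = degree (u0 * v1)"
    proof (cases "v0 = 0")
      case False
      then have "degree (u1 * v0) < degree (u0 * v1)"
        using v0 v1 u0 \<open>u1 \<noteq> 0\<close> by (simp add: degree_mult_eq)
      then show ?thesis
        by (rule degree_add_eq_left)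
    qed simp
    then show False
      using big deg_S by simp
  qed
  moreover have "no_common_prime u1 v1"
    unfolding no_common_prime_def
  proof (intro allI impI notI)
    fix r :: "'a poly"
    assume r: "prime_elem r" and "r dvd u1 \<and> r dvd v1"
    then have "r dvd \<alpha>" "r dvd \<gamma>" and S2: "r dvd 2 * S"
      using u1 v01 sum by auto
    then have p: "r dvd u - t * v" and q: "r dvd t * u - B * v"
      using prime_elem_dvd_power[OF r] by (auto simp: \<alpha>_def \<gamma>_def diff_form_def prod_form_def)
    have not_const: "\<not> r dvd [:c:]" if "c \<noteq> 0" for c
      using that r dvd_unit_imp_unit[of r "[:c:]"]
      by (auto simp: prime_elem_def is_unit_const_poly_iff dvd_field_iff)
    have "\<not> r dvd 2"
      using not_const[OF two] by (simp add: numeral_poly)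
    then have S: "r dvd S"
      using S2 r by (simp add: prime_elem_dvd_mult_iff)
    have "\<not> r dvd v"
    proof
      assume "r dvd v"
      then have "r dvd u"
        using dvd_add[OF p dvd_mult[of r v t]] by simp
      then show False
        using \<open>r dvd v\<close> cop r by (auto simp: no_common_prime_def)
    qed
    have "r dvd (t\<^sup>2 - B) * v"
    proof -
      have "(t\<^sup>2 - B) * v = (t * u - B * v) - t * (u - t * v)"
        by algebra
      then show ?thesis
        using dvd_diff[OF q dvd_mult[OF p, of t]] by simp
    qed
    then have tB: "r dvd t\<^sup>2 - B"
      using \<open>\<not> r dvd v\<close> r by (simp add: prime_elem_dvd_mult_iff)
    have "r dvd 2 * t\<^sup>2 * (2 * t + A) * v\<^sup>2"
    proof -
      have "2 * t\<^sup>2 * (2 * t + A) * v\<^sup>2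
          = S - (u - t * v) * (t * (u - t * v) + 3 * t\<^sup>2 * v + B * v + 2 * A * t * v)
            + (t\<^sup>2 - B) * (2 * t * v\<^sup>2)"
        unfolding S_def half_sum_form_def by algebra
      then show ?thesis
        by (simp only:) (intro dvd_add dvd_diff dvd_mult2 S p tB)
    qed
    moreover have "\<not> r dvd t"
    proof
      assume "r dvd t"
      then have "r dvd t\<^sup>2 - (t\<^sup>2 - B)"
        using tB by (intro dvd_diff[OF _ tB]) (simp add: power2_eq_square)
      then show False
        using not_const[OF b] by (simp add: B_def)
    qed
    ultimately have "r dvd 2 * t + A"
      using \<open>\<not> r dvd v\<close> \<open>\<not> r dvd 2\<close> r
      by (auto simp: prime_elem_dvd_mult_iff dest: prime_elem_dvd_power)
    then have "r dvd (2 * t + A) * (A - 2 * t) + (t\<^sup>2 - B) * 4"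
      using tB by (intro dvd_add[OF dvd_mult2 dvd_mult2])
    also have "(2 * t + A) * (A - 2 * t) + (t\<^sup>2 - B) * 4 = A\<^sup>2 - 4 * B"
      by algebra
    also have "\<dots> = [:a\<^sup>2 - 4 * b:]"
      by (simp add: A_def B_def power2_eq_square numeral_poly)
    finally show False
      using not_const[of "a\<^sup>2 - 4 * b"] disc by simp
  qed
  ultimately have "reduced_point u1 v1"
    using \<open>u1 \<noteq> 0\<close> by (simp add: reduced_point_def)
  moreover have "translate_form t A B u1 v1 u v = 0"
    using rel1 by (simp add: translate_form_sym)
  ultimately show ?thesis
    using deg_sum by blast
qed

text \<open>
  The degrees \<open>d n\<close> of the numerators along the sequence of translates have constant second
  difference \<open>2\<close>, so \<open>d n\<close> is the quadratic polynomial with the given values at \<open>0\<close> and \<open>1\<close>.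
\<close>
lemma translate_degree_nonneg:
  fixes a b :: "'a::field" and t A B u v u0 v0 :: "'a poly"
  defines "t \<equiv> [:0, 1:]" and "A \<equiv> [:a:]" and "B \<equiv> [:b:]"
  assumes two: "(2::'a) \<noteq> 0" and b: "b \<noteq> 0" and disc: "a\<^sup>2 \<noteq> 4 * b"
    and red0: "reduced_point u0 v0" and red: "reduced_point u v"
    and rel: "translate_form t A B u v u0 v0 = 0"
  shows "(int n)\<^sup>2 + (int (degree u) - int (degree u0) - 1) * int n + int (degree u0) \<ge> 0"
proof -
  let ?d = "\<lambda>n. (int n)\<^sup>2 + (int (degree u) - int (degree u0) - 1) * int n + int (degree u0)"
  have "\<exists>u' v' u'' v''. reduced_point u' v' \<and> reduced_point u'' v''
      \<and> translate_form t A B u'' v'' u' v' = 0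
      \<and> int (degree u') = ?d n \<and> int (degree u'') = ?d (Suc n)"
  proof (induction n)
    case 0
    show ?case
      using red0 red rel by (intro exI[of _ u0] exI[of _ v0] exI[of _ u] exI[of _ v]) auto
  next
    case (Suc n)
    then obtain u' v' u'' v'' where red': "reduced_point u' v'" "reduced_point u'' v''"
      and rel': "translate_form t A B u'' v'' u' v' = 0"
      and deg: "int (degree u') = ?d n" "int (degree u'') = ?d (Suc n)"
      by blast
    obtain u1 v1 where red1: "reduced_point u1 v1" and rel1: "translate_form t A B u1 v1 u'' v'' = 0"
      and deg1: "degree u1 + degree u' = 2 * degree u'' + 2"
      using translate_step[OF two b disc red' rel'[unfolded t_def A_def B_def]]
      unfolding t_def A_def B_def by blast
    have "int (degree u1) = ?d (Suc (Suc n))"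
      using deg deg1 by (simp add: algebra_simps power2_eq_square)
    then show ?case
      using red' red1 rel1 deg(2) by blast
  qed
  then show ?thesis
    by (metis of_nat_0_le_iff)
qed


section \<open>The quadratic character of a finite field of odd order\<close>
lemma power_card_field:
  fixes x :: "'a::{field, finite}"
  shows "x ^ CARD('a) = x"
proof (cases "x = 0")
  case False
  have "(\<Prod>y\<in>UNIV - {0}. x * y) = (\<Prod>y\<in>UNIV - {0 :: 'a}. y)"
    by (rule prod.reindex_bij_witness[of _ "\<lambda>y. y / x" "\<lambda>y. x * y"]) (use False in auto)
  then have "x ^ (CARD('a) - 1) * (\<Prod>y\<in>UNIV - {0 :: 'a}. y) = (\<Prod>y\<in>UNIV - {0 :: 'a}. y)"
    by (simp add: prod.distrib)
  then have "x ^ (CARD('a) - 1) = 1"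
    by simp
  moreover have "x ^ CARD('a) = x * x ^ (CARD('a) - 1)"
    using power_Suc[of x "CARD('a) - 1"] by simp
  ultimately show ?thesis
    by simp
qed simp

lemma two_neq_zero_if_odd_card:
  assumes "odd (CARD('a::{field, finite}))"
  shows "(2 :: 'a) \<noteq> 0"
proof
  assume two: "(2 :: 'a) = 0"
  have "(\<Sum>x\<in>UNIV. x + 1) = (\<Sum>x\<in>UNIV. x :: 'a)"
    by (rule sum.reindex_bij_witness[of _ "\<lambda>x. x - 1" "\<lambda>x. x + 1"]) auto
  then have "of_nat CARD('a) = (0 :: 'a)"
    by (simp add: sum.distrib)
  moreover obtain k where "CARD('a) = 2 * k + 1"
    using assms by (elim oddE)
  ultimately show False
    using two by simp
qed

definition quad_char :: "'a::field \<Rightarrow> int" where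
  "quad_char x = (if x = 0 then 0 else if \<exists>y. x = y\<^sup>2 then 1 else -1)"

lemma quad_char_0 [simp]: "quad_char 0 = 0"
  by (simp add: quad_char_def)

lemma quad_char_1 [simp]: "quad_char 1 = 1"
  by (auto simp: quad_char_def intro: exI[of _ 1])

lemma quad_char_values: "quad_char x \<in> {-1, 0, 1}"
  by (simp add: quad_char_def)

lemma quad_char_eq_0_iff: "quad_char x = 0 \<longleftrightarrow> x = 0"
  by (simp add: quad_char_def)

lemma quad_char_eq_minus_1_iff: "quad_char x = -1 \<longleftrightarrow> (\<forall>y. x \<noteq> y\<^sup>2)"
  by (auto simp: quad_char_def)

text \<open>Squaring is at most two-to-one.\<close>
lemma card_le_twice_card_squares:
  "CARD('a::{field, finite}) - 1 \<le> 2 * card {z::'a. z \<noteq> 0 \<and> (\<exists>y. z = y\<^sup>2)}"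
proof -
  let ?Q = "{z::'a. z \<noteq> 0 \<and> (\<exists>y. z = y\<^sup>2)}"
  have "card {y. y\<^sup>2 = z} \<le> 2" if z: "z \<in> ?Q" for z :: 'a
  proof -
    obtain y where "z = y\<^sup>2"
      using z by blast
    then have "{y. y\<^sup>2 = z} \<subseteq> {y, -y}"
      by (auto simp: power2_eq_iff)
    then have "card {y. y\<^sup>2 = z} \<le> card {y, -y}"
      by (intro card_mono) auto
    also have "\<dots> \<le> 2"
      by (simp add: card_insert_if)
    finally show ?thesis .
  qed
  then have "(\<Sum>z\<in>?Q. card {y. y\<^sup>2 = z}) \<le> 2 * card ?Q"
    using sum_bounded_above[of ?Q "\<lambda>z. card {y. y\<^sup>2 = z}" 2] by simp
  moreover have "card (UNIV - {0::'a}) \<le> card (\<Union>z\<in>?Q. {y. y\<^sup>2 = z})"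
    by (intro card_mono) auto
  moreover have "card (\<Union>z\<in>?Q. {y. y\<^sup>2 = z}) \<le> (\<Sum>z\<in>?Q. card {y. y\<^sup>2 = z})"
    by (intro card_UN_le) auto
  ultimately show ?thesis
    by (simp add: card_Diff_singleton)
qed

lemma card_power_eq_1_le:
  assumes "0 < m"
  shows "card {x::'a::field. x ^ m = 1} \<le> m"
proof -
  let ?p = "monom 1 m - 1 :: 'a poly"
  have "coeff ?p m = 1"
    using assms by (simp add: coeff_eq_0)
  then have "?p \<noteq> 0"
    by force
  then have "card {x. poly ?p x = 0} \<le> degree ?p"
    by (rule card_poly_roots_bound)
  also have "\<dots> \<le> m"
    by (intro degree_diff_le degree_monom_le) auto
  finally show ?thesis
    by (simp add: poly_monom)
qed

text \<open>
  With \<open>m = (q - 1) / 2\<close>, the nonzero squares are roots of \<open>x^m = 1\<close>. There are at least \<open>m\<close> of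
  the former and at most \<open>m\<close> of the latter, so the two sets coincide.
\<close>
lemma euler_criterion_finite_field:
  fixes x :: "'a::{field, finite}"
  assumes "odd CARD('a)"
  shows "of_int (quad_char x) = x ^ ((CARD('a) - 1) div 2)"
proof -
  define m where "m = (CARD('a) - 1) div 2"
  have "card {0, 1 :: 'a} \<le> CARD('a)"
    by (intro card_mono) auto
  then have "m > 0" and card: "CARD('a) = Suc (2 * m)"
    using assms by (auto simp: m_def elim!: oddE)
  have pow: "y ^ (2 * m) = 1" if "y \<noteq> 0" for y :: 'a
    using power_card_field[of y] that unfolding card by simp
  let ?Q = "{z::'a. z \<noteq> 0 \<and> (\<exists>y. z = y\<^sup>2)}" and ?R = "{z::'a. z ^ m = 1}"
  have "?Q \<subseteq> ?R"
    using pow by (auto simp: power_mult[symmetric])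
  moreover have "card ?R \<le> card ?Q"
    using card_power_eq_1_le[OF \<open>m > 0\<close>, where 'a = 'a] card_le_twice_card_squares[where 'a = 'a]
    unfolding card by simp
  ultimately have QR: "?Q = ?R"
    by (intro card_seteq) auto
  show ?thesis
  proof (cases "x = 0")
    case True
    then show ?thesis
      using \<open>m > 0\<close> by (simp add: m_def)
  next
    case False
    have "(x ^ m)\<^sup>2 = 1"
      using pow[OF False] by (simp add: power_mult[symmetric] mult.commute)
    then have "x ^ m = 1 \<or> x ^ m = -1"
      by (simp add: power2_eq_1_iff)
    moreover have "x ^ m = 1 \<longleftrightarrow> (\<exists>y. x = y\<^sup>2)"
      using QR False by (auto simp: set_eq_iff)
    ultimately show ?thesis
      using False unfolding m_def[symmetric] by (auto simp: quad_char_def)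
  qed
qed

lemma of_int_sign_inject:
  assumes "(2::'a::field) \<noteq> 0" and "i \<in> {-1, 0, 1::int}" "j \<in> {-1, 0, 1}"
    and "of_int i = (of_int j :: 'a)"
  shows "i = j"
proof -
  have "(1::'a) \<noteq> -1"
  proof
    assume "(1::'a) = -1"
    then have "1 + 1 = (0::'a)"
      by (simp add: eq_neg_iff_add_eq_0)
    then show False
      using assms(1) by simp
  qed
  then show ?thesis
    using assms(2-) not_sym[OF \<open>(1::'a) \<noteq> -1\<close>] by auto
qed

lemma quad_char_mult:
  fixes x y :: "'a::{field, finite}"
  assumes "odd CARD('a)"
  shows "quad_char (x * y) = quad_char x * quad_char y"
proof (rule of_int_sign_inject[OF two_neq_zero_if_odd_card[OF assms]])
  show "of_int (quad_char (x * y)) = (of_int (quad_char x * quad_char y) :: 'a)"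
    by (simp add: euler_criterion_finite_field[OF assms] power_mult_distrib)
  show "quad_char x * quad_char y \<in> {-1, 0, 1}"
    using quad_char_values[of x] quad_char_values[of y] by auto
qed (rule quad_char_values)

text \<open>Multiplication by a nonsquare permutes the field and changes the sign of the sum.\<close>
lemma sum_quad_char:
  assumes "odd CARD('a::{field, finite})"
  shows "(\<Sum>x\<in>UNIV. quad_char (x::'a)) = 0"
proof -
  obtain g :: 'a where g: "g \<noteq> 0" "quad_char g = -1"
  proof -
    define m where "m = (CARD('a) - 1) div 2"
    have "card {0, 1 :: 'a} \<le> CARD('a)"
      by (intro card_mono) auto
    then have "m > 0" and card: "CARD('a) = Suc (2 * m)"
      using assms by (auto simp: m_def elim!: oddE)
    have "card {x::'a. x ^ m = 1} < card (UNIV - {0::'a})"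
      using card_power_eq_1_le[OF \<open>m > 0\<close>, where 'a = 'a] card \<open>m > 0\<close>
      by (simp add: card_Diff_singleton)
    then have "\<not> UNIV - {0::'a} \<subseteq> {x::'a. x ^ m = 1}"
      by (meson card_mono finite leD)
    then obtain g :: 'a where "g \<noteq> 0" "g ^ m \<noteq> 1"
      by auto
    moreover from this have "quad_char g \<noteq> 1"
      using euler_criterion_finite_field[OF assms, of g] by (auto simp: m_def)
    ultimately show ?thesis
      using that[of g] by (auto simp: quad_char_def split: if_splits)
  qed
  have "(\<Sum>x\<in>UNIV. quad_char (x::'a)) = (\<Sum>x\<in>UNIV. quad_char (g * x))"
    by (rule sum.reindex_bij_witness[of _ "\<lambda>x. g * x" "\<lambda>x. x / g"]) (use g in auto)
  also have "\<dots> = - (\<Sum>x\<in>UNIV. quad_char (x::'a))"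
    by (simp add: quad_char_mult[OF assms] g sum_negf)
  finally show ?thesis
    by simp
qed

lemma sum_quad_char_shift:
  assumes "odd CARD('a::{field, finite})"
  shows "(\<Sum>x\<in>UNIV. quad_char (x - a :: 'a)) = 0"
proof -
  have "(\<Sum>x\<in>UNIV. quad_char (x - a)) = (\<Sum>x\<in>UNIV. quad_char (x :: 'a))"
    by (rule sum.reindex_bij_witness[of _ "\<lambda>x. x + a" "\<lambda>x. x - a"]) auto
  then show ?thesis
    using sum_quad_char[OF assms] by simp
qed

text \<open>
  Up to the square \<open>(x - b)\<^sup>2\<close>, the product \<open>(x - a) (x - b)\<close> is \<open>(x - a) / (x - b)\<close>, and this
  Moebius transformation maps the field without \<open>b\<close> bijectively to the field without \<open>1\<close>.
\<close>
lemma sum_quad_char_quadratic: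
  fixes a b :: "'a::{field, finite}"
  assumes odd: "odd CARD('a)" and "a \<noteq> b"
  shows "(\<Sum>x\<in>UNIV. quad_char (x - a) * quad_char (x - b)) = -1"
proof -
  have "(\<Sum>x\<in>UNIV. quad_char (x - a) * quad_char (x - b))
      = (\<Sum>x\<in>UNIV - {b}. quad_char (x - a) * quad_char (x - b))"
    by (intro sum.mono_neutral_right) auto
  also have "\<dots> = (\<Sum>x\<in>UNIV - {b}. quad_char ((x - a) / (x - b)))"
  proof (rule sum.cong[OF refl])
    fix x assume "x \<in> UNIV - {b}"
    then have "x - b \<noteq> 0"
      by simp
    then have "quad_char (x - b) * quad_char (x - b) = 1"
      using quad_char_values[of "x - b"] quad_char_eq_0_iff[of "x - b"] by auto
    moreover have "quad_char (x - a) = quad_char ((x - a) / (x - b)) * quad_char (x - b)"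
      using \<open>x - b \<noteq> 0\<close> by (simp add: quad_char_mult[OF odd, symmetric])
    ultimately show "quad_char (x - a) * quad_char (x - b) = quad_char ((x - a) / (x - b))"
      by (simp add: mult.assoc)
  qed
  also have "\<dots> = (\<Sum>y\<in>UNIV - {1}. quad_char (y :: 'a))"
  proof (rule sum.reindex_bij_witness[of _ "\<lambda>y. b + (b - a) / (y - 1)" "\<lambda>x. (x - a) / (x - b)"])
    fix x assume "x \<in> UNIV - {b}"
    then have "(x - a) / (x - b) - 1 = (b - a) / (x - b)"
      by (simp add: divide_simps)
    then show "b + (b - a) / ((x - a) / (x - b) - 1) = x" and "(x - a) / (x - b) \<in> UNIV - {1}"
      using assms(2) \<open>x \<in> UNIV - {b}\<close> by auto
  next
    fix y :: 'a assume "y \<in> UNIV - {1}"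
    then show "(b + (b - a) / (y - 1) - a) / (b + (b - a) / (y - 1) - b) = y"
      and "b + (b - a) / (y - 1) \<in> UNIV - {b}"
      using assms(2) by (auto simp: divide_simps) (simp_all add: algebra_simps)
  qed simp
  also have "\<dots> = (\<Sum>y\<in>UNIV. quad_char (y::'a)) - quad_char (1::'a)"
    by (simp add: sum_diff1)
  finally show ?thesis
    using sum_quad_char[OF odd] by simp
qed


section \<open>Hasse's bound for a split cubic\<close>
definition split_poly :: "'a::field set \<Rightarrow> 'a poly" where
  "split_poly S = (\<Prod>x\<in>S. [:-x, 1:])"

lemma degree_split_poly: "finite S \<Longrightarrow> degree (split_poly S) = card S"
  unfolding split_poly_def by (subst degree_prod_eq_sum_degree) auto

lemma split_poly_neq_0: "finite S \<Longrightarrow> split_poly S \<noteq> 0"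
  by (auto simp: split_poly_def)

lemma lead_coeff_split_poly: "lead_coeff (split_poly S) = 1"
  by (simp add: split_poly_def lead_coeff_prod)

lemma poly_split_poly_eq_0: "finite S \<Longrightarrow> x \<in> S \<Longrightarrow> poly (split_poly S) x = 0"
  by (auto simp: split_poly_def poly_prod)

lemma split_poly_dvd:
  assumes "finite S" and "\<And>x. x \<in> S \<Longrightarrow> poly g x = 0"
  shows "split_poly S dvd (g :: 'a::field poly)"
  using assms
proof (induction S arbitrary: g rule: finite_induct)
  case empty
  then show ?case
    by (simp add: split_poly_def)
next
  case (insert y S)
  then obtain h where h: "g = [:-y, 1:] * h"
    using poly_eq_0_iff_dvd[of g y] by (auto elim: dvdE)
  have "poly h x = 0" if "x \<in> S" for x
    using insert.prems[of x] insert.hyps that unfolding h by auto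
  then have "split_poly S dvd h"
    by (rule insert.IH)
  then show ?case
    unfolding h using insert.hyps by (simp add: split_poly_def mult_dvd_mono del: mult_pCons_left)
qed

lemma prime_dvd_split_poly:
  assumes "finite S" and r: "prime_elem r" and "r dvd split_poly S"
  shows "\<exists>x\<in>S. \<forall>g. r dvd g \<longrightarrow> poly g x = (0 :: 'a::field)"
proof -
  obtain x where x: "x \<in> S" "r dvd [:-x, 1:]"
  proof -
    have "\<exists>x\<in>S. r dvd [:-x, 1:]"
      using assms(1,3)
    proof (induction S rule: finite_induct)
      case empty
      then show ?case
        using r by (simp add: split_poly_def prime_elem_def)
    next
      case (insert y S)
      then show ?case
        using r by (auto simp: split_poly_def prime_elem_dvd_mult_iff simp del: mult_pCons_left)
    qed
    then show ?thesis
      using that by blast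
  qed
  then obtain k where k: "[:-x, 1:] = r * k"
    by (elim dvdE)
  have "irreducible [:-x, 1:]"
    by (rule irreducible_linear_field_poly) simp
  then have "is_unit r \<or> is_unit k"
    using k by (auto dest: irreducibleD)
  then have "is_unit k"
    using r by (auto simp: prime_elem_def)
  then obtain c where "k = [:c:]" "c \<noteq> 0"
    by (auto simp: is_unit_poly_iff dvd_field_iff)
  then have "poly r x = 0"
    using arg_cong[OF k, of "\<lambda>p. poly p x"] by simp
  then have "\<forall>g. r dvd g \<longrightarrow> poly g x = 0"
    by (auto elim: dvdE)
  then show ?thesis
    using x(1) by blast
qed

text \<open>
  Both sides are monic of degree \<open>q\<close> and vanish on the whole field. Comparing the cases \<open>c\<close> and
  \<open>0\<close> gives \<open>(t - c)^q = t^q - c\<close>, which replaces the Frobenius endomorphism below.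
\<close>
lemma linear_power_card_minus_linear:
  fixes c :: "'a::{field, finite}"
  shows "[:-c, 1:] ^ CARD('a) - [:-c, 1:] = split_poly UNIV"
proof (rule poly_eqI_degree_lead_coeff[where n = "CARD('a)" and A = UNIV])
  have "card {0, 1 :: 'a} \<le> CARD('a)"
    by (intro card_mono) auto
  then have q: "CARD('a) > 1"
    by simp
  have deg: "degree ([:-c, 1:] ^ CARD('a)) = CARD('a)"
    by (simp add: degree_power_eq)
  have "lead_coeff ([:-c, 1:] ^ CARD('a)) = 1"
    by (simp add: lead_coeff_power)
  then have "coeff ([:-c, 1:] ^ CARD('a)) CARD('a) = 1"
    by (simp only: deg)
  moreover have "coeff (split_poly (UNIV :: 'a set)) CARD('a) = 1"
    using lead_coeff_split_poly[of "UNIV :: 'a set"] by (simp add: degree_split_poly)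
  moreover have "coeff [:-c, 1:] CARD('a) = 0"
    using q by (intro coeff_eq_0) simp
  ultimately show "coeff ([:-c, 1:] ^ CARD('a) - [:-c, 1:]) CARD('a)
      = coeff (split_poly (UNIV :: 'a set)) CARD('a)"
    by simp
  show "degree ([:-c, 1:] ^ CARD('a) - [:-c, 1:]) \<le> CARD('a)"
    using q by (intro degree_diff_le) (simp_all add: deg)
  show "degree (split_poly (UNIV :: 'a set)) \<le> CARD('a)"
    by (simp add: degree_split_poly)
qed (simp_all add: poly_split_poly_eq_0 power_card_field)

text \<open>
  With \<open>X = t^q\<close> and \<open>W = F^((q-1)/2)\<close>, so that \<open>F(X) = F W\<^sup>2\<close>, the addition formula gives one
  translate of \<open>(X, W)\<close> by \<open>(t, 1)\<close> the \<open>x\<close>-coordinate \<open>(S + 2 F W) / (X - t)\<^sup>2\<close>, where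
  \<open>S + 2 F W = F (W + 1)\<^sup>2 - (A + t + X) (X - t)\<^sup>2\<close>. The denominator is the product of the
  \<open>(t - x)\<^sup>2\<close> over the field, and \<open>W(x)\<close> is the quadratic character of \<open>F(x)\<close>. So \<open>(t - x)\<^sup>2\<close>
  cancels when \<open>F(x)\<close> is a nonsquare, one factor \<open>t - x\<close> cancels when \<open>F(x) = 0\<close>, and nothing
  cancels when \<open>F(x)\<close> is a nonzero square. The degree of what remains in the numerator thus
  counts the values of the character, which is how \<open>T\<close> enters.
\<close>
lemma frobenius_translate_pair:
  fixes r s :: "'a::{field, finite}" and A B t X :: "'a poly"
  defines "A \<equiv> [:-(r + s):]" and "B \<equiv> [:r * s:]" and "t \<equiv> [:0, 1:]" and "X \<equiv> t ^ CARD('a)"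
  defines "T \<equiv> \<Sum>x\<in>UNIV. quad_char (x * (x - r) * (x - s))"
  assumes odd: "odd CARD('a)" and "r \<noteq> 0" "s \<noteq> 0" "r \<noteq> s"
  shows "even T"
    and "\<exists>M E. reduced_point M E \<and> int (degree M) = int CARD('a) + 1 + T
           \<and> translate_form t A B X 1 M E = 0"
proof -
  define q where "q = CARD('a)"
  define m where "m = (q - 1) div 2"
  have two: "(2::'a) \<noteq> 0"
    by (rule two_neq_zero_if_odd_card[OF odd])
  have "card {0, 1 :: 'a} \<le> CARD('a)"
    by (intro card_mono) auto
  then have "m > 0" and qm: "q = 2 * m + 1"
    using odd by (auto simp: m_def q_def elim!: oddE)
  define f where "f = (\<lambda>x. x * (x - r) * (x - s))"
  define F where "F = t * (t - [:r:]) * (t - [:s:])"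
  have poly_F: "poly F x = f x" for x
    by (simp add: F_def f_def t_def algebra_simps)
  have F_eq: "F = t * (t\<^sup>2 + A * t + B)"
    by (simp add: F_def t_def A_def B_def power2_eq_square algebra_simps)
  define Z where "Z = {0, r, s}"
  define P where "P = {x. quad_char (f x) = 1}"
  define N where "N = {x. quad_char (f x) = -1}"
  have Z_iff: "x \<in> Z \<longleftrightarrow> quad_char (f x) = 0" for x
    by (auto simp: Z_def quad_char_eq_0_iff f_def)
  have disj: "Z \<inter> P = {}" "(Z \<union> P) \<inter> N = {}"
    by (auto simp: Z_iff P_def N_def)
  have "x \<in> Z \<union> P \<union> N" for x
    using quad_char_values[of "f x"] by (auto simp: Z_iff P_def N_def)
  then have UNIV_eq: "UNIV = Z \<union> P \<union> N"
    by auto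
  have "card Z = 3"
    using assms by (simp add: Z_def)
  have "q = card (Z \<union> P \<union> N)"
    unfolding q_def by (rule arg_cong[OF UNIV_eq])
  also have "\<dots> = card Z + card P + card N"
    using disj by (simp add: card_Un_disjoint)
  finally have card: "q = 3 + card P + card N"
    using \<open>card Z = 3\<close> by simp
  have T: "T = int (card P) - int (card N)"
  proof -
    have "T = (\<Sum>x\<in>Z \<union> P \<union> N. quad_char (f x))"
      unfolding T_def f_def by (rule sum.cong[OF UNIV_eq refl])
    also have "\<dots> = (\<Sum>x\<in>Z. quad_char (f x)) + (\<Sum>x\<in>P. quad_char (f x)) + (\<Sum>x\<in>N. quad_char (f x))"
      using disj by (simp add: sum.union_disjoint)
    also have "(\<Sum>x\<in>Z. quad_char (f x)) = 0"
      by (intro sum.neutral) (simp add: Z_iff)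
    also have "(\<Sum>x\<in>P. quad_char (f x)) = int (card P)"
      by (simp add: P_def)
    also have "(\<Sum>x\<in>N. quad_char (f x)) = - int (card N)"
      by (simp add: N_def)
    finally show ?thesis
      by simp
  qed
  show "even T"
    using card T qm by presburger

  have F_split: "F = split_poly Z"
    using assms by (simp add: F_def split_poly_def Z_def t_def mult.assoc)
  have split_UNIV: "split_poly UNIV = split_poly Z * split_poly P * split_poly N"
    unfolding split_poly_def UNIV_eq using disj by (simp add: prod.union_disjoint)
  have X_minus_t: "X - t = split_poly UNIV"
    using linear_power_card_minus_linear[of 0] by (simp add: X_def t_def)
  have shifted: "(t - [:c:]) ^ q = X - [:c:]" for c
  proof -
    have tc: "t - [:c:] = [:-c, 1:]"
      by (simp add: t_def)
    have "(t - [:c:]) ^ q - (t - [:c:]) = X - t"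
      unfolding tc q_def X_minus_t by (rule linear_power_card_minus_linear)
    then show ?thesis
      by (simp add: algebra_simps)
  qed
  have F_power: "F ^ q = X * (X\<^sup>2 + A * X + B)"
  proof -
    have "F ^ q = X * (X - [:r:]) * (X - [:s:])"
      by (simp add: F_def power_mult_distrib shifted) (simp add: X_def q_def)
    also have "\<dots> = X * (X\<^sup>2 + A * X + B)"
    proof -
      have "A = - [:r:] - [:s:]" "B = [:r:] * [:s:]"
        by (simp_all add: A_def B_def)
      then show ?thesis
        by algebra
    qed
    finally show ?thesis .
  qed

  define W where "W = F ^ m"
  have poly_W: "poly W x = of_int (quad_char (f x))" for x
    by (simp add: W_def poly_F euler_criterion_finite_field[OF odd] m_def q_def)
  have FW: "F * W\<^sup>2 = F ^ q"
    by (simp add: W_def qm power_mult[symmetric] mult.commute)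
  have "split_poly N dvd W + 1"
    by (intro split_poly_dvd) (auto simp: poly_W N_def)
  then obtain k where k: "W + 1 = split_poly N * k" ..
  \<comment> \<open>The fraction \<open>M / E\<close> is \<open>(S + 2 F W) / (X - t)\<^sup>2\<close> in lowest terms, after cancelling \<open>g\<close>.\<close>
  define E where "E = split_poly Z * (split_poly P)\<^sup>2"
  define M where "M = k\<^sup>2 - (A + t + X) * E"
  define g where "g = split_poly Z * (split_poly N)\<^sup>2"
  have "g \<noteq> 0"
    by (simp add: g_def split_poly_neq_0)
  define S where "S = half_sum_form t A B X 1"
  define \<alpha> where "\<alpha> = diff_form t X 1"
  define \<gamma> where "\<gamma> = prod_form t B X 1"
  have gE: "g * E = \<alpha>"
  proof -
    have "\<alpha> = (split_poly UNIV)\<^sup>2"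
      by (simp add: \<alpha>_def diff_form_def X_minus_t[symmetric])
    then show ?thesis
      by (simp add: g_def E_def split_UNIV power2_eq_square mult_ac)
  qed
  have gM: "g * M = S + 2 * F * W"
  proof -
    have "g * M = F * (W + 1)\<^sup>2 - (A + t + X) * (g * E)"
      unfolding k by (simp add: M_def g_def F_split power2_eq_square algebra_simps)
    also have "\<dots> = F * W\<^sup>2 + 2 * F * W + F - (A + t + X) * (X - t)\<^sup>2"
      unfolding gE \<alpha>_def diff_form_def by (simp add: power2_eq_square algebra_simps)
    also have "\<dots> = S + 2 * F * W"
      unfolding FW F_power unfolding F_eq S_def half_sum_form_def
      by (simp add: power2_eq_square algebra_simps)
    finally show ?thesis .
  qed
  have rel: "translate_form t A B X 1 M E = 0"
  proof -
    have "S\<^sup>2 - \<alpha> * \<gamma> = 4 * F * (F * W\<^sup>2)"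
      unfolding FW F_power S_def \<alpha>_def \<gamma>_def discriminant_identity unfolding F_eq
      by (simp add: mult.assoc)
    moreover have "(g * M)\<^sup>2 - 2 * S * (g * M) + \<alpha> * \<gamma>
        = 4 * F * (F * W\<^sup>2) - (S\<^sup>2 - \<alpha> * \<gamma>)"
      unfolding gM by (simp add: power2_eq_square algebra_simps)
    ultimately have "(g * M)\<^sup>2 - 2 * S * (g * M) + \<alpha> * \<gamma> = 0"
      by simp
    moreover have "g\<^sup>2 * translate_form t A B X 1 M E
        = \<alpha> * (g * M)\<^sup>2 - 2 * S * (g * M) * (g * E) + \<gamma> * (g * E)\<^sup>2"
      unfolding translate_form_def S_def \<alpha>_def \<gamma>_def
      by (simp add: power2_eq_square algebra_simps)
    moreover have "\<alpha> * (g * M)\<^sup>2 - 2 * S * (g * M) * (g * E) + \<gamma> * (g * E)\<^sup>2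
        = \<alpha> * ((g * M)\<^sup>2 - 2 * S * (g * M) + \<alpha> * \<gamma>)"
      unfolding gE by (simp add: power2_eq_square algebra_simps)
    ultimately show ?thesis
      using \<open>g \<noteq> 0\<close> by simp
  qed

  have deg_X: "degree X = q"
    by (simp add: X_def t_def degree_power_eq q_def)
  have "degree (g * M) = 2 * q + 1"
  proof -
    \<comment> \<open>\<open>t * X\<^sup>2\<close> dominates the numerator: the rest has degree at most \<open>q + 2\<close> or \<open>3 + 3 m < 4 m + 3 = 2 q + 1\<close>.\<close>
    define R where "R = A * X * t + B * X + B * t + (t\<^sup>2 + A * t) * X + 2 * F * W"
    have t2: "degree (t\<^sup>2 + A * t) \<le> 2"
      by (intro degree_add_le) (auto simp: t_def A_def power2_eq_square)
    have deg_F: "degree F = 3"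
      using \<open>card Z = 3\<close> by (simp add: F_split degree_split_poly Z_def)
    have FW_le: "degree (2 * F * W) \<le> 3 + 3 * m"
    proof -
      have "2 * F * W = smult 2 (F * W)"
        by (simp add: numeral_poly)
      moreover have "degree W \<le> 3 * m"
        using degree_power_le[of F m] by (simp add: W_def deg_F)
      ultimately show ?thesis
        using degree_mult_le[of F W] deg_F by (simp add: two)
    qed
    have "degree (A * X) \<le> q" "degree (B * X) \<le> q"
      by (simp_all add: A_def B_def deg_X)
    moreover have "degree t = 1"
      by (simp add: t_def)
    ultimately have "degree (A * X * t) \<le> q + 2" "degree (B * X) \<le> q + 2"
      and "degree (B * t) \<le> q + 2" "degree ((t\<^sup>2 + A * t) * X) \<le> q + 2"
      using degree_mult_le[of "A * X" t] degree_mult_le[of "t\<^sup>2 + A * t" X] t2 deg_X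
      by (auto simp: B_def)
    then have "degree R \<le> 2 * q"
      unfolding R_def using FW_le qm \<open>m > 0\<close> by (intro degree_add_le) auto
    moreover have "degree (t * X\<^sup>2) = 2 * q + 1"
      using deg_X \<open>degree t = 1\<close> by (subst degree_mult_eq) (auto simp: degree_power_eq X_def t_def)
    moreover have "g * M = t * X\<^sup>2 + R"
      unfolding gM R_def S_def half_sum_form_def by (simp add: power2_eq_square algebra_simps)
    ultimately show ?thesis
      by (simp add: degree_add_eq_left)
  qed
  moreover from this have "M \<noteq> 0"
    by auto
  ultimately have deg_M: "degree M = 4 + 2 * card P"
    using \<open>g \<noteq> 0\<close> card \<open>card Z = 3\<close>
    by (simp add: degree_mult_eq g_def degree_power_eq degree_split_poly split_poly_neq_0)
  have deg_E: "degree E = 3 + 2 * card P"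
    using \<open>card Z = 3\<close>
    by (simp add: E_def degree_mult_eq degree_power_eq degree_split_poly split_poly_neq_0)
  have "no_common_prime M E"
    unfolding no_common_prime_def
  proof (intro allI impI notI)
    fix l assume l: "prime_elem l" and "l dvd M \<and> l dvd E"
    then have lM: "l dvd M" and lE: "l dvd E"
      by auto
    have "l dvd split_poly Z \<or> l dvd split_poly P"
      using lE prime_elem_dvd_power[OF l] l by (auto simp: E_def prime_elem_dvd_mult_iff)
    then obtain x where x: "x \<in> Z \<union> P" and root: "\<forall>g. l dvd g \<longrightarrow> poly g x = 0"
      using prime_dvd_split_poly[OF _ l, of Z] prime_dvd_split_poly[OF _ l, of P] by auto
    have "poly M x = 0" "poly E x = 0"
      using root lM lE by auto
    then have "poly k x = 0"
      by (simp add: M_def)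
    then have "poly (W + 1) x = 0"
      by (simp add: k)
    then have "of_int (quad_char (f x)) + 1 = (0 :: 'a)"
      by (simp add: poly_W)
    then show False
      using x two by (auto simp: Z_iff P_def)
  qed
  then have "reduced_point M E"
    using \<open>M \<noteq> 0\<close> deg_M deg_E by (simp add: reduced_point_def)
  moreover have "int (degree M) = int CARD('a) + 1 + T"
    using deg_M T card by (simp add: q_def)
  ultimately show "\<exists>M E. reduced_point M E \<and> int (degree M) = int CARD('a) + 1 + T
           \<and> translate_form t A B X 1 M E = 0"
    using rel by blast
qed

text \<open>
  The sequence of translates is followed in the direction that reaches \<open>n = - T / 2\<close>: starting
  from \<open>d 0 = q\<close>, \<open>d 1 = q + 1 + T\<close> if \<open>T \<le> 0\<close>, and from the same two values in the opposite
  order, with the index shifted by one, if \<open>T > 0\<close>.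
\<close>
lemma hasse_bound_split_cubic:
  fixes r s :: "'a::{field, finite}"
  assumes odd: "odd CARD('a)" and "r \<noteq> 0" "s \<noteq> 0" "r \<noteq> s"
  shows "(\<Sum>x\<in>UNIV. quad_char (x * (x - r) * (x - s)))\<^sup>2 \<le> 4 * int CARD('a)"
proof -
  define T where "T = (\<Sum>x\<in>UNIV. quad_char (x * (x - r) * (x - s)))"
  define q where "q = CARD('a)"
  obtain M E where red: "reduced_point M E" and deg_M: "int (degree M) = int q + 1 + T"
    and rel: "translate_form [:0, 1:] [:-(r + s):] [:r * s:] ([:0, 1:] ^ q) 1 M E = 0"
    using frobenius_translate_pair(2)[OF assms] unfolding T_def q_def by blast
  obtain h where h: "T = 2 * h"
    using frobenius_translate_pair(1)[OF assms] unfolding T_def by (elim evenE)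
  have q: "degree ([:0, 1:] ^ q :: 'a poly) = q" "q > 0"
    by (simp_all add: degree_power_eq q_def)
  then have red0: "reduced_point ([:0, 1:] ^ q :: 'a poly) 1"
    by (auto simp: reduced_point_def no_common_prime_def prime_elem_def)
  have two: "(2::'a) \<noteq> 0"
    by (rule two_neq_zero_if_odd_card[OF odd])
  have rs: "r * s \<noteq> 0"
    using assms by simp
  have "(-(r + s))\<^sup>2 - 4 * (r * s) = (r - s)\<^sup>2"
    by (simp add: power2_eq_square algebra_simps)
  then have disc: "(-(r + s))\<^sup>2 \<noteq> 4 * (r * s)"
    using assms(4) by auto
  note nonneg = translate_degree_nonneg[OF two rs disc]
  have "h\<^sup>2 \<le> int q"
  proof (cases "h \<le> 0")
    case True
    have "0 \<le> (int (nat (-h)))\<^sup>2 + (int (degree M) - int q - 1) * int (nat (-h)) + int q"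
      using nonneg[OF red0 red, of "nat (-h)"] rel q(1) by (simp add: translate_form_sym)
    then show ?thesis
      using True h deg_M by (simp add: power2_eq_square algebra_simps)
  next
    case False
    have "0 \<le> (int (nat (h + 1)))\<^sup>2 + (int q - int (degree M) - 1) * int (nat (h + 1)) + int (degree M)"
      using nonneg[OF red red0 rel, of "nat (h + 1)"] q(1) by simp
    then show ?thesis
      using False h deg_M by (simp add: power2_eq_square algebra_simps)
  qed
  then show ?thesis
    using h unfolding T_def q_def by (simp add: power_mult_distrib)
qed


section \<open>Counting leaves\<close>
lemma mem_leaves_iff:
  "v \<in> leaves (poly_graph [monom 1 2 + [:a:], monom 1 2 + [:b:], monom 1 2 + [:c:]])
     \<longleftrightarrow> quad_char (v - a) = -1 \<and> quad_char (v - b) = -1 \<and> quad_char (v - c) = -1"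
proof -
  let ?fs = "[monom 1 2 + [:a:], monom 1 2 + [:b:], monom 1 2 + [:c:]]"
  have "in_arcs (poly_graph ?fs) v
      = {(u, w). w = v \<and> (v = u\<^sup>2 + a \<or> v = u\<^sup>2 + b \<or> v = u\<^sup>2 + c)}"
    by (auto simp: in_arcs_def poly_graph_def poly_monom)
  then have "v \<in> leaves (poly_graph ?fs)
      \<longleftrightarrow> {(u, w). w = v \<and> (v = u\<^sup>2 + a \<or> v = u\<^sup>2 + b \<or> v = u\<^sup>2 + c)} = {}"
    by (simp add: leaves_def in_degree_def poly_graph_def card_eq_0_iff)
  also have "\<dots> \<longleftrightarrow> (\<forall>u. v \<noteq> u\<^sup>2 + a \<and> v \<noteq> u\<^sup>2 + b \<and> v \<noteq> u\<^sup>2 + c)"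
    by auto
  also have "\<dots> \<longleftrightarrow> (\<forall>u. v - a \<noteq> u\<^sup>2) \<and> (\<forall>u. v - b \<noteq> u\<^sup>2) \<and> (\<forall>u. v - c \<noteq> u\<^sup>2)"
    by (auto simp: diff_eq_eq)
  finally show ?thesis
    by (simp add: quad_char_eq_minus_1_iff)
qed

text \<open>
  The gap of \<open>12\<close> between the two bounds comes from the vertices \<open>a\<close>, \<open>b\<close>, \<open>c\<close>, where one of the
  characters is \<open>0\<close> and the product of the three factors is at most \<open>4\<close>.
\<close>
lemma leaf_count_char_sum:
  fixes a b c :: "'a::{field, finite}"
  assumes odd: "odd CARD('a)" and abc: "a \<noteq> b" "a \<noteq> c" "b \<noteq> c"
  defines "T \<equiv> \<Sum>x\<in>UNIV. quad_char ((x - a) * (x - b) * (x - c))"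
  shows "8 * int (leaf_count a b c) \<le> int CARD('a) - 3 - T"
    and "int CARD('a) - 15 - T \<le> 8 * int (leaf_count a b c)"
proof -
  define L where "L = leaves (poly_graph [monom 1 2 + [:a:], monom 1 2 + [:b:], monom 1 2 + [:c:]])"
  define \<chi> where "\<chi> = (quad_char :: 'a \<Rightarrow> int)"
  define G where "G = (\<lambda>v. (1 - \<chi> (v - a)) * (1 - \<chi> (v - b)) * (1 - \<chi> (v - c)))"
  have vals: "\<chi> x = -1 \<or> \<chi> x = 0 \<or> \<chi> x = 1" for x
    using quad_char_values[of x] by (auto simp: \<chi>_def)
  have nz: "\<chi> x \<noteq> 0" if "x \<noteq> 0" for x
    using that by (simp add: \<chi>_def quad_char_eq_0_iff)
  have mem_L: "v \<in> L \<longleftrightarrow> \<chi> (v - a) = -1 \<and> \<chi> (v - b) = -1 \<and> \<chi> (v - c) = -1" for v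
    unfolding L_def \<chi>_def by (rule mem_leaves_iff)
  have "\<chi> 0 = 0"
    by (simp add: \<chi>_def)
  have outside: "G v = (if v \<in> L then 8 else 0)" if "v \<notin> {a, b, c}" for v
  proof -
    have sign: "\<chi> (v - x) = -1 \<or> \<chi> (v - x) = 1" if "x \<in> {a, b, c}" for x
      using vals[of "v - x"] nz[of "v - x"] that \<open>v \<notin> {a, b, c}\<close> by auto
    show ?thesis
      using sign[of a] sign[of b] sign[of c] unfolding mem_L G_def by auto
  qed
  have pair: "0 \<le> (1 - \<chi> x) * (1 - \<chi> y) \<and> (1 - \<chi> x) * (1 - \<chi> y) \<le> 4" for x y
    using vals[of x] vals[of y] by auto
  have inside: "0 \<le> G v \<and> G v \<le> 4" if "v \<in> {a, b, c}" for v
    using that pair[of "a - b" "a - c"] pair[of "b - a" "b - c"] pair[of "c - a" "c - b"]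
    unfolding G_def by (auto simp: \<open>\<chi> 0 = 0\<close>)
  have "L \<inter> {a, b, c} = {}"
    by (auto simp: mem_L \<chi>_def)
  then have "(\<Sum>v\<in>UNIV - {a, b, c}. G v) = 8 * int (card L)"
  proof -
    have "(\<Sum>v\<in>UNIV - {a, b, c}. G v) = (\<Sum>v\<in>UNIV - {a, b, c}. if v \<in> L then 8 else 0)"
      by (intro sum.cong) (use outside in auto)
    also have "\<dots> = (\<Sum>v\<in>(UNIV - {a, b, c}) \<inter> L. 8)"
      by (subst sum.inter_restrict) auto
    also have "(UNIV - {a, b, c}) \<inter> L = L"
      using \<open>L \<inter> {a, b, c} = {}\<close> by auto
    finally show ?thesis
      by simp
  qed
  moreover have "(\<Sum>v\<in>UNIV. G v) = (\<Sum>v\<in>UNIV - {a, b, c}. G v) + (\<Sum>v\<in>{a, b, c}. G v)"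
    by (rule sum.subset_diff) auto
  moreover have "0 \<le> (\<Sum>v\<in>{a, b, c}. G v)"
    by (intro sum_nonneg) (use inside in auto)
  moreover have "(\<Sum>v\<in>{a, b, c}. G v) \<le> 12"
    using inside[of a] inside[of b] inside[of c] abc by simp
  moreover have "(\<Sum>v\<in>UNIV. G v) = int CARD('a) - 3 - T"
  proof -
    have "(\<Sum>v\<in>UNIV. G v) = (\<Sum>v\<in>UNIV. 1 - \<chi> (v - a) - \<chi> (v - b) - \<chi> (v - c)
        + \<chi> (v - a) * \<chi> (v - b) + \<chi> (v - a) * \<chi> (v - c) + \<chi> (v - b) * \<chi> (v - c)
        - \<chi> ((v - a) * (v - b) * (v - c)))"
      unfolding G_def \<chi>_def quad_char_mult[OF odd] by (simp add: algebra_simps)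
    also have "\<dots> = int CARD('a) - 3 - T"
      using abc unfolding T_def \<chi>_def
      by (simp add: sum.distrib sum_subtractf sum_quad_char_shift[OF odd]
          sum_quad_char_quadratic[OF odd])
    finally show ?thesis .
  qed
  moreover have "leaf_count a b c = card L"
    by (simp add: leaf_count_def L_def)
  ultimately show "8 * int (leaf_count a b c) \<le> int CARD('a) - 3 - T"
    and "int CARD('a) - 15 - T \<le> 8 * int (leaf_count a b c)"
    by linarith+
qed

theorem corollary2p7:
  fixes p k q :: nat and a b c :: "'a::{field, finite}"
  assumes "prime p" and "odd p" and "k \<ge> 1" and "q = p ^ k"
    and "CARD('a) = q"
    and "a \<noteq> b" and "a \<noteq> c" and "b \<noteq> c"
  shows "\<bar>real (leaf_count a b c) - real q / 8\<bar> \<le> 1 / 4 * sqrt (real q) + 2"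
proof -
  have odd: "odd CARD('a)"
    using assms by simp
  define T where "T = (\<Sum>x\<in>UNIV. quad_char ((x - a) * (x - b) * (x - c)))"
  have "T = (\<Sum>x\<in>UNIV. quad_char (x * (x - (b - a)) * (x - (c - a))))"
    unfolding T_def
    by (rule sum.reindex_bij_witness[of _ "\<lambda>x. x + a" "\<lambda>x. x - a"]) (auto simp: algebra_simps)
  then have "T\<^sup>2 \<le> 4 * int q"
    using hasse_bound_split_cubic[OF odd, of "b - a" "c - a"] assms by simp
  then have "real_of_int (T\<^sup>2) \<le> real_of_int (4 * int q)"
    by (simp only: of_int_le_iff)
  then have "\<bar>real_of_int T\<bar>\<^sup>2 \<le> (2 * sqrt (real q))\<^sup>2"
    by (simp add: power_mult_distrib)
  then have T: "\<bar>real_of_int T\<bar> \<le> 2 * sqrt (real q)"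
    by (rule power2_le_imp_le) simp
  have "8 * int (leaf_count a b c) \<le> int q - 3 - T" and "int q - 15 - T \<le> 8 * int (leaf_count a b c)"
    using leaf_count_char_sum[OF odd assms(6-8)] unfolding T_def assms(5) by auto
  then have "8 * real (leaf_count a b c) \<le> real q - 3 - real_of_int T"
    and "real q - 15 - real_of_int T \<le> 8 * real (leaf_count a b c)"
    by linarith+
  then show ?thesis
    using T by (auto simp: abs_le_iff field_simps)
qed

end
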